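(* Let $k\ge 1$ be an integer. The set $\mathrm{RedVHC}_k(\mathrm{Av}(312))$ is in bijection with the set of underlined duck words of length $3k$. Specifically, for each integer $i$ with $0\le i\le k-1$, the set $\mathrm{RedVHC}_k(\mathrm{Av}_{3k-i}(312))$ is in bijection with the set of $(k,i)$-underlined duck words.
   Context: $S_n$ is the set of permutations $\pi=\pi_1\cdots\pi_n$ of $\{1,\dots,n\}$. $\pi$ is $312$-avoiding if there are no indices $a<b<c$ with $\pi_b<\pi_c<\pi_a$; $\mathrm{Av}_n(312)\subseteq S_n$ is the set of $312$-avoiding permutations of length $n$, and $\mathrm{Av}(312)=\bigcup_n \mathrm{Av}_n(312)$. The plot of $\pi$ is the set of points $(i,\pi_i)$, $1\le i\le n$. If $\pi_i>\pi_{i+1}$, then $i$ is a descent, $(i,\pi_i)$ is a descent top and $(i+1,\pi_{i+1})$ is a descent bottom. A hook on $\pi$ from $(i,\pi_i)$ to $(j,\pi_j)$, where $i<j$ and $\pi_i<\pi_j$, consists of the vertical segment from $(i,\pi_i)$ up to $(i,\pi_j)$ followed by the horizontal segment from $(i,\pi_j)$ to $(j,\pi_j)$. The point $(i,\pi_i)$ is its southwest (SW) endpoint and $(j,\pi_j)$ its northeast (NE) endpoint. A valid hook configuration on $\pi$ is a set of hooks on $\pi$ such that: (i) the set of SW endpoints of the hooks is exactly the set of descent tops of $\pi$; (ii) no point of the plot lies directly above a hook (for a hook from $(i,\pi_i)$ to $(j,\pi_j)$ there is no $l$ with $i<l<j$ and $\pi_l>\pi_j$); (iii) distinct hooks do not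 intersect, except at endpoints (the NE endpoint of one hook may be the SW endpoint of another; two hooks sharing the same NE endpoint, or the same SW endpoint, overlap in a segment and are not allowed). It is reduced if every point of the plot is a hook endpoint or a descent bottom (or both). For a set $S$ of permutations, $\mathrm{RedVHC}_k(S)$ is the set of all reduced valid hook configurations with exactly $k$ hooks on permutations in $S$ (a configuration includes the data of its underlying permutation). A 3D-Dyck word of length $3k$ is a word with $k$ letters X, $k$ letters Y and $k$ letters Z such that in every prefix the number of X's is at least the number of Y's, which is at least the number of Z's. An underlined duck word of length $3k$ is a 3D-Dyck word of length $3k$ in which some (possibly zero) of the Y's are underlined, such that no underlined Y has an X immediately before it. A $(k,i)$-underlined duck word is an underlined duck word of length $3k$ with exactly $i$ underlined Y's. *)

theory Defs
  imports "HOL-Analysis.Analysis" "HOL-Combinatorics.Multiset_Permutations"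
begin

text \<open>
  A permutation of \<open>{1..n}\<close> is its list of values, so
  \<open>S\<^sub>n\<close> is \<open>permutations_of_set {1..n}\<close> and the length is recovered from the list.
  All positions of a permutation are counted from 1, as in the plot.
\<close>

definition entry :: "nat list \<Rightarrow> nat \<Rightarrow> nat" where
  "entry \<pi> i = \<pi> ! (i - 1)"

definition avoids_312 :: "nat list \<Rightarrow> bool" where
  "avoids_312 \<pi> \<longleftrightarrow>
     \<not> (\<exists>a b c. 1 \<le> a \<and> a < b \<and> b < c \<and> c \<le> length \<pi> \<and>
          entry \<pi> b < entry \<pi> c \<and> entry \<pi> c < entry \<pi> a)"

definition Av312_n :: "nat \<Rightarrow> nat list set" where
  "Av312_n n = {\<pi> \<in> permutations_of_set {1..n}. avoids_312 \<pi>}"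

definition Av312 :: "nat list set" where
  "Av312 = (\<Union>n. Av312_n n)"

definition pt :: "nat list \<Rightarrow> nat \<Rightarrow> nat \<times> nat" where
  "pt \<pi> i = (i, entry \<pi> i)"

definition plot :: "nat list \<Rightarrow> (nat \<times> nat) set" where
  "plot \<pi> = pt \<pi> ` {1..length \<pi>}"

definition descents :: "nat list \<Rightarrow> nat set" where
  "descents \<pi> = {i. 1 \<le> i \<and> i < length \<pi> \<and> entry \<pi> i > entry \<pi> (i + 1)}"

definition descent_tops :: "nat list \<Rightarrow> (nat \<times> nat) set" where
  "descent_tops \<pi> = pt \<pi> ` descents \<pi>"

definition descent_bottoms :: "nat list \<Rightarrow> (nat \<times> nat) set" where
  "descent_bottoms \<pi> = (\<lambda>i. pt \<pi> (i + 1)) ` descents \<pi>"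

text \<open>
  The hook from \<open>(i, \<pi>\<^sub>i)\<close> to \<open>(j, \<pi>\<^sub>j)\<close> is encoded by the pair of positions \<open>(i, j)\<close>;
  the curve it stands for in the plane is \<open>hook_curve \<pi> (i, j)\<close>.
\<close>

definition is_hook :: "nat list \<Rightarrow> nat \<times> nat \<Rightarrow> bool" where
  "is_hook \<pi> = (\<lambda>(i, j).
     1 \<le> i \<and> i < j \<and> j \<le> length \<pi> \<and> entry \<pi> i < entry \<pi> j)"

definition sw_endpoint :: "nat list \<Rightarrow> nat \<times> nat \<Rightarrow> nat \<times> nat" where
  "sw_endpoint \<pi> h = pt \<pi> (fst h)"

definition ne_endpoint :: "nat list \<Rightarrow> nat \<times> nat \<Rightarrow> nat \<times> nat" where
  "ne_endpoint \<pi> h = pt \<pi> (snd h)"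

definition endpoints :: "nat list \<Rightarrow> nat \<times> nat \<Rightarrow> (nat \<times> nat) set" where
  "endpoints \<pi> h = {sw_endpoint \<pi> h, ne_endpoint \<pi> h}"

definition hook_curve :: "nat list \<Rightarrow> nat \<times> nat \<Rightarrow> (real \<times> real) set" where
  "hook_curve \<pi> = (\<lambda>(i, j).
     closed_segment (real i, real (entry \<pi> i)) (real i, real (entry \<pi> j)) \<union>
     closed_segment (real i, real (entry \<pi> j)) (real j, real (entry \<pi> j)))"

text \<open>
  Two hooks meet at most in points that are endpoints of both. Hooks sharing their SW
  endpoints, or their NE endpoints, overlap in a whole segment and so are excluded.
\<close>

definition meet_only_at_endpoints :: "nat list \<Rightarrow> nat \<times> nat \<Rightarrow> nat \<times> nat \<Rightarrow> bool" where
  "meet_only_at_endpoints \<pi> h h' \<longleftrightarrow>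
     hook_curve \<pi> h \<inter> hook_curve \<pi> h' \<subseteq>
       map_prod real real ` (endpoints \<pi> h \<inter> endpoints \<pi> h')"

definition valid_hook_config :: "nat list \<Rightarrow> (nat \<times> nat) set \<Rightarrow> bool" where
  "valid_hook_config \<pi> H \<longleftrightarrow>
     (\<forall>h\<in>H. is_hook \<pi> h) \<and>
     sw_endpoint \<pi> ` H = descent_tops \<pi> \<and>
     (\<forall>(i, j)\<in>H. \<not> (\<exists>l. i < l \<and> l < j \<and> entry \<pi> l > entry \<pi> j)) \<and>
     (\<forall>h\<in>H. \<forall>h'\<in>H. h \<noteq> h' \<longrightarrow> meet_only_at_endpoints \<pi> h h')"

definition reduced :: "nat list \<Rightarrow> (nat \<times> nat) set \<Rightarrow> bool" where
  "reduced \<pi> H \<longleftrightarrow> (\<forall>p\<in>plot \<pi>. p \<in> (\<Union>h\<in>H. endpoints \<pi> h) \<or> p \<in> descent_bottoms \<pi>)"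

definition RedVHC :: "nat \<Rightarrow> nat list set \<Rightarrow> (nat list \<times> (nat \<times> nat) set) set" where
  "RedVHC k S =
     {(\<pi>, H). \<pi> \<in> S \<and> valid_hook_config \<pi> H \<and> reduced \<pi> H \<and> card H = k}"

datatype letter = X | Y | Z

definition dyck3_words :: "nat \<Rightarrow> letter list set" where
  "dyck3_words k =
     {w. count_list w X = k \<and> count_list w Y = k \<and> count_list w Z = k \<and>
         (\<forall>m\<le>length w. count_list (take m w) X \<ge> count_list (take m w) Y \<and>
                       count_list (take m w) Y \<ge> count_list (take m w) Z)}"

text \<open>
  An underlined word is a pair of a word and the set of the (0-based) list positions of
  its underlined letters.
\<close>

definition underlined_duck_words :: "nat \<Rightarrow> (letter list \<times> nat set) set" where
  "underlined_duck_words k =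
     {(w, U). w \<in> dyck3_words k \<and> U \<subseteq> {p. p < length w \<and> w ! p = Y} \<and>
              (\<forall>p\<in>U. \<not> (p > 0 \<and> w ! (p - 1) = X))}"

definition underlined_duck_words_i :: "nat \<Rightarrow> nat \<Rightarrow> (letter list \<times> nat set) set" where
  "underlined_duck_words_i k i = {(w, U) \<in> underlined_duck_words k. card U = i}"

end

theory Submission imports Defs begin

text \<open>
  In a valid hook configuration on a 312-avoiding permutation every NE endpoint is a left-to-right
  maximum, so two hooks avoid each other exactly when they are nested or disjoint as intervals of
  positions. The hooks are thus determined by the set \<open>N\<close> of their NE endpoints: they are the
  parenthesis matching of the descent tops with \<open>N\<close>, which exists exactly when the ballot condition
  holds.

  A 312-avoiding permutation is the output of a stack on which \<open>1, 2, \<dots>\<close> are pushed in this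
  order, and its descending runs start with the element just pushed. Write \<open>X\<close> for a value that is
  pushed but not output at once (a descent bottom), \<open>Z\<close> for an output value that is a NE endpoint,
  \<open>Y\<close> for the output of a value that is not a NE endpoint together with the descent bottom after it,
  and an underlined \<open>Y\<close> for every further pop. An underlined \<open>Y\<close> never follows an \<open>X\<close>,
  the stack yields the inequality between \<open>X\<close> and \<open>Y\<close>, and the ballot condition the one between
  \<open>Y\<close> and \<open>Z\<close>. A plain \<open>Y\<close> outputs two values, a \<open>Z\<close> or an underlined \<open>Y\<close> one, so the
  permutation has length \<open>3k - i\<close> if \<open>i\<close> letters are underlined.
\<close>

section \<open>Hooks as noncrossing matchings\<close>

definition noncrossing_matching :: "nat set \<Rightarrow> nat set \<Rightarrow> (nat \<times> nat) set \<Rightarrow> bool" where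
  "noncrossing_matching T N H \<longleftrightarrow>
     fst ` H = T \<and> snd ` H = N \<and> (\<forall>(i, j)\<in>H. i < j) \<and>
     (\<forall>(i, j)\<in>H. \<forall>(i', j')\<in>H. (i = i' \<longrightarrow> j = j') \<and> (i < i' \<longrightarrow> j \<le> i' \<or> j' < j))"

definition ballot :: "nat set \<Rightarrow> nat set \<Rightarrow> bool" where
  "ballot T N \<longleftrightarrow> card T = card N \<and> (\<forall>j\<in>N. card {x \<in> N. x < j} < card {x \<in> T. x < j})"

lemma noncrossing_matchingD:
  assumes "noncrossing_matching T N H"
  shows "fst ` H = T" "snd ` H = N" "(i, j) \<in> H \<Longrightarrow> i < j"
    "(i, j) \<in> H \<Longrightarrow> (i, j') \<in> H \<Longrightarrow> j = j'"
    "(i, j) \<in> H \<Longrightarrow> (i', j') \<in> H \<Longrightarrow> i < i' \<Longrightarrow> j \<le> i' \<or> j' < j"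
  using assms unfolding noncrossing_matching_def by blast+

lemma noncrossing_matching_inj:
  assumes "noncrossing_matching T N H"
  shows "inj_on fst H" "inj_on snd H"
proof -
  note D = noncrossing_matchingD[OF assms]
  show "inj_on fst H"
    by (rule inj_onI, clarsimp) (rule D(4))
  show "inj_on snd H"
  proof (rule inj_onI, clarsimp)
    fix i j i' assume "(i, j) \<in> H" "(i', j) \<in> H"
    then show "i = i'"
      using D(3)[of i j] D(3)[of i' j] D(5)[of i j i' j] D(5)[of i' j i j]
      by (cases i i' rule: linorder_cases) auto
  qed
qed

text \<open>The pairs ending at or before \<open>j\<close> include one for \<open>j\<close> itself
  and one for each smaller element of \<open>N\<close>. Their left ends are distinct and lie before
  \<open>j\<close>.\<close>

lemma noncrossing_matching_ballot:
  assumes m: "noncrossing_matching T N H" and fin: "finite T"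
  shows "ballot T N"
  unfolding ballot_def
proof (intro conjI ballI)
  note D = noncrossing_matchingD[OF m]
  note I = noncrossing_matching_inj[OF m]
  show "card T = card N"
    using card_image[OF I(1)] card_image[OF I(2)] D(1,2) by simp
  have finH: "finite H"
    using D(1) I(1) fin finite_image_iff by metis
  fix j assume j: "j \<in> N"
  let ?H = "{h \<in> H. snd h \<le> j}"
  have "{x \<in> N. x < j} \<subset> snd ` ?H"
  proof
    show "{x \<in> N. x < j} \<subseteq> snd ` ?H"
      unfolding D(2)[symmetric] by auto
    have "j \<in> snd ` ?H" using j unfolding D(2)[symmetric] by auto
    then show "{x \<in> N. x < j} \<noteq> snd ` ?H" by blast
  qed
  then have "card {x \<in> N. x < j} < card (snd ` ?H)"
    using finH by (intro psubset_card_mono) auto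
  also have "\<dots> = card (fst ` ?H)"
    using I by (metis (no_types, lifting) card_image inj_on_subset mem_Collect_eq subsetI)
  also have "\<dots> \<le> card {x \<in> T. x < j}"
  proof (intro card_mono subsetI)
    fix i assume "i \<in> fst ` ?H"
    then obtain j' where "(i, j') \<in> H" "j' \<le> j" by auto
    then show "i \<in> {x \<in> T. x < j}" using D(1) D(3)[of i j'] by force
  qed (use fin in simp)
  finally show "card {x \<in> N. x < j} < card {x \<in> T. x < j}" .
qed

text \<open>If the nearest element of \<open>T\<close> to the left of \<open>Min N\<close> were not
  matched with it, the pair starting there would end later and cross the pair ending at
  \<open>Min N\<close>. Uniqueness follows by peeling off this forced pair.\<close>

lemma noncrossing_matching_Min:
  assumes m: "noncrossing_matching T N H" and fin: "finite T" "finite N" and N: "N \<noteq> {}"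
  shows "(Max {x \<in> T. x < Min N}, Min N) \<in> H"
proof -
  note D = noncrossing_matchingD[OF m]
  let ?j = "Min N" and ?i = "Max {x \<in> T. x < Min N}"
  have "?j \<in> N" using fin N by simp
  then obtain i where i: "(i, ?j) \<in> H" using D(2) by auto
  have "i \<in> {x \<in> T. x < ?j}" using i D(1,3) by force
  moreover have "finite {x \<in> T. x < ?j}" using fin by simp
  ultimately have "?i \<in> {x \<in> T. x < ?j}" and iM: "i \<le> ?i"
    using Max_in[of "{x \<in> T. x < ?j}"] Max_ge[of "{x \<in> T. x < ?j}" i] by blast+
  then have iT: "?i \<in> T" "?i < ?j" unfolding mem_Collect_eq by blast+
  show ?thesis
  proof (cases "i = ?i")
    case False
    then have lt: "i < ?i" using iM by simp
    obtain j' where j': "(?i, j') \<in> H" using iT(1) D(1) by auto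
    then have "?j \<le> j'" using D(2) fin(2) by (metis Min_le image_eqI snd_conv)
    then show ?thesis
      using D(5)[OF i j' lt] iT(2) by linarith
  qed (use i in simp)
qed

lemma noncrossing_matching_remove:
  assumes m: "noncrossing_matching T N H" and h: "(i, j) \<in> H"
  shows "noncrossing_matching (T - {i}) (N - {j}) (H - {(i, j)})"
proof -
  note D = noncrossing_matchingD[OF m]
  note I = noncrossing_matching_inj[OF m]
  have "fst ` (H - {(i, j)}) = T - {i}"
    using D(1) h inj_on_image_set_diff[OF I(1), of H "{(i,j)}"] by auto
  moreover have "snd ` (H - {(i, j)}) = N - {j}"
    using D(2) h inj_on_image_set_diff[OF I(2), of H "{(i,j)}"] by auto
  ultimately show ?thesis
    using m unfolding noncrossing_matching_def by blast
qed

lemma noncrossing_matching_unique: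
  assumes "noncrossing_matching T N H" "noncrossing_matching T N H'" "finite T" "finite N"
  shows "H = H'"
  using assms
proof (induction "card N" arbitrary: T N H H')
  case 0
  then have "N = {}" by simp
  then show ?case using 0 noncrossing_matchingD(2) by (metis image_is_empty)
next
  case (Suc n)
  then have ne: "N \<noteq> {}" by auto
  let ?j = "Min N" and ?i = "Max {x \<in> T. x < Min N}"
  note h = noncrossing_matching_Min[OF Suc.prems(1,3,4) ne] noncrossing_matching_Min[OF Suc.prems(2,3,4) ne]
  have "H - {(?i, ?j)} = H' - {(?i, ?j)}"
    using Suc.hyps(1)[OF _ noncrossing_matching_remove[OF Suc.prems(1) h(1)]
        noncrossing_matching_remove[OF Suc.prems(2) h(2)]] Suc.hyps(2) Suc.prems(3,4) ne
    by simp
  then show ?case using h by blast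
qed

text \<open>Greedy construction: the least element of \<open>N\<close> is paired with the nearest
  element of \<open>T\<close> to its left. The ballot condition survives, since below any later
  element of \<open>N\<close> both counts drop by exactly one.\<close>

lemma noncrossing_matching_exists:
  assumes "ballot T N" "finite T" "finite N"
  shows "\<exists>H. noncrossing_matching T N H"
  using assms
proof (induction "card N" arbitrary: T N)
  case 0
  then have "N = {}" "T = {}" by (auto simp: ballot_def)
  then show ?case by (intro exI[of _ "{}"]) (simp add: noncrossing_matching_def)
next
  case (Suc n)
  then have ne: "N \<noteq> {}" by auto
  define j where "j = Min N"
  define i where "i = Max {x \<in> T. x < j}"
  have j: "j \<in> N" "\<And>x. x \<in> N \<Longrightarrow> j \<le> x" using Suc.prems ne by (auto simp: j_def)
  have "card {x \<in> T. x < j} > 0"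
    using Suc.prems(1) j(1) unfolding ballot_def by force
  then have "{x \<in> T. x < j} \<noteq> {}" by force
  then have "i \<in> {x \<in> T. x < j}"
    unfolding i_def using Suc.prems by (intro Max_in) auto
  then have i: "i \<in> T" "i < j" by auto
  have imax: "x \<le> i" if "x \<in> T" "x < j" for x
    using that Suc.prems unfolding i_def by simp
  have "ballot (T - {i}) (N - {j})"
    unfolding ballot_def
  proof (intro conjI ballI)
    show "card (T - {i}) = card (N - {j})"
      using Suc.prems i j by (simp add: ballot_def)
    fix x assume x: "x \<in> N - {j}"
    then have jx: "j < x" using j(2)[of x] by auto
    have "{y \<in> N - {j}. y < x} = {y \<in> N. y < x} - {j}"
      "{y \<in> T - {i}. y < x} = {y \<in> T. y < x} - {i}" by auto
    moreover have "card {y \<in> N. y < x} < card {y \<in> T. y < x}"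
      using Suc.prems(1) x unfolding ballot_def by blast
    moreover have "card {y \<in> N. y < x} > 0"
      using j jx Suc.prems(3) by (auto simp: card_gt_0_iff)
    ultimately show "card {y \<in> N - {j}. y < x} < card {y \<in> T - {i}. y < x}"
      using i j jx Suc.prems(2,3) by (simp add: card_Diff_singleton)
  qed
  then obtain H where H: "noncrossing_matching (T - {i}) (N - {j}) H"
    using Suc.hyps(1)[of "N - {j}" "T - {i}"] Suc.hyps(2) Suc.prems(2,3) j(1)
    by (metis (no_types) card_Suc_Diff1 finite_Diff nat.inject)
  note D = noncrossing_matchingD[OF H]
  \<comment> \<open>By maximality of \<open>i\<close> no remaining pair starts strictly between
    \<open>i\<close> and \<open>j\<close>, and all of them end after \<open>j\<close>; hence the new
    pair crosses none of them.\<close>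
  have new: "i' \<noteq> i \<and> j < j' \<and> (i < i' \<longrightarrow> j \<le> i')" if "(i', j') \<in> H" for i' j'
  proof -
    have "i' \<in> T - {i}" "j' \<in> N - {j}" using that D(1,2) by force+
    then show ?thesis using imax[of i'] j(2)[of j'] by force
  qed
  have "noncrossing_matching T N (insert (i, j) H)"
    unfolding noncrossing_matching_def
  proof (intro conjI)
    show "fst ` insert (i, j) H = T" "snd ` insert (i, j) H = N"
      using D(1,2) i j by auto
    show "\<forall>(i, j)\<in>insert (i, j) H. i < j" using D(3) i by auto
    show "\<forall>(a, b)\<in>insert (i, j) H. \<forall>(a', b')\<in>insert (i, j) H.
        (a = a' \<longrightarrow> b = b') \<and> (a < a' \<longrightarrow> b \<le> a' \<or> b' < b)"
    proof (intro ballI case_prodI2 conjI impI)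
      fix p a b q a' b'
      assume ab: "p \<in> insert (i, j) H" "p = (a, b)" "q \<in> insert (i, j) H" "q = (a', b')"
      show "b = b'" if "a = a'"
        using ab that new[of a b] new[of a' b'] D(4)[of a b b'] by auto
      show "b \<le> a' \<or> b' < b" if "a < a'"
        using ab that new[of a b] new[of a' b'] D(5)[of a b a' b'] by auto
    qed
  qed
  then show ?case by blast
qed

section \<open>Intersections of hooks in the plane\<close>

lemma hook_curve_eq:
  assumes "is_hook \<pi> (i, j)"
  shows "hook_curve \<pi> (i, j) =
    {real i} \<times> {real (entry \<pi> i)..real (entry \<pi> j)} \<union> {real i..real j} \<times> {real (entry \<pi> j)}"
  using assms
  by (simp add: hook_curve_def is_hook_def closed_segment_same_fst closed_segment_same_snd
      closed_segment_eq_real_ivl)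

lemma meet_only_at_endpoints_commute:
  "meet_only_at_endpoints \<pi> h h' \<longleftrightarrow> meet_only_at_endpoints \<pi> h' h"
  by (simp add: meet_only_at_endpoints_def Int_commute)

lemma meet_only_at_endpoints_same_sw:
  assumes "is_hook \<pi> (i, j)" "is_hook \<pi> (i, j')"
  shows "\<not> meet_only_at_endpoints \<pi> (i, j) (i, j')"
proof
  let ?m = "min (entry \<pi> j) (entry \<pi> j')"
  assume m: "meet_only_at_endpoints \<pi> (i, j) (i, j')"
  \<comment> \<open>The vertical segments overlap up to height \<open>?m\<close>, but in this column
    the only possible endpoint is the shared SW one, which is strictly lower.\<close>
  have "(real i, real ?m) \<in> hook_curve \<pi> (i, j) \<inter> hook_curve \<pi> (i, j')"
    using assms unfolding hook_curve_eq[OF assms(1)] hook_curve_eq[OF assms(2)]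
    by (auto simp: is_hook_def)
  from subsetD[OF m[unfolded meet_only_at_endpoints_def] this] have "?m = entry \<pi> i"
    using assms by (auto simp: endpoints_def sw_endpoint_def ne_endpoint_def pt_def is_hook_def)
  then show False using assms by (auto simp: is_hook_def min_def split: if_splits)
qed

text \<open>When the right ends are left-to-right maxima, the heights of the horizontal segments are
  ordered like their right ends. The geometric condition therefore depends on positions
  only.\<close>

lemma meet_only_at_endpoints_iff:
  assumes h: "is_hook \<pi> (i, j)" and h': "is_hook \<pi> (i', j')" and lt: "i < i'"
    and max: "\<And>l. 1 \<le> l \<Longrightarrow> l < j \<Longrightarrow> entry \<pi> l < entry \<pi> j"
    and max': "\<And>l. 1 \<le> l \<Longrightarrow> l < j' \<Longrightarrow> entry \<pi> l < entry \<pi> j'"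
  shows "meet_only_at_endpoints \<pi> (i, j) (i', j') \<longleftrightarrow> j \<le> i' \<or> j' < j"
proof
  note E = hook_curve_eq[OF h] hook_curve_eq[OF h']
  note b = h[unfolded is_hook_def, simplified] h'[unfolded is_hook_def, simplified]
  {
    assume m: "meet_only_at_endpoints \<pi> (i, j) (i', j')"
    show "j \<le> i' \<or> j' < j"
    proof (rule ccontr)
      assume "\<not> (j \<le> i' \<or> j' < j)"
      then have "i' < j" "j \<le> j'" by auto
      then have "entry \<pi> i' < entry \<pi> j" "entry \<pi> j \<le> entry \<pi> j'"
        using max[of i'] max'[of j] b by (cases "j = j'"; force)+
      \<comment> \<open>Here the vertical segment of the second hook meets the horizontal segment of
        the first. The abscissa lies strictly between \<open>i\<close> and \<open>j\<close>, so the
        point is no endpoint of the first hook.\<close>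
      then have "(real i', real (entry \<pi> j)) \<in> hook_curve \<pi> (i, j) \<inter> hook_curve \<pi> (i', j')"
        using lt \<open>i' < j\<close> unfolding E by auto
      from subsetD[OF m[unfolded meet_only_at_endpoints_def] this] show False
        using lt \<open>i' < j\<close> by (auto simp: endpoints_def sw_endpoint_def ne_endpoint_def pt_def)
    qed
  }
  {
    assume c: "j \<le> i' \<or> j' < j"
    show "meet_only_at_endpoints \<pi> (i, j) (i', j')"
    proof (cases "j' < j")
      case True
      then have "entry \<pi> j' < entry \<pi> j" using max[of j'] b by auto
      then have "hook_curve \<pi> (i, j) \<inter> hook_curve \<pi> (i', j') = {}"
        using lt True b unfolding E by auto
      then show ?thesis unfolding meet_only_at_endpoints_def by simp
    next
      case False
      then have le: "j \<le> i'" using c by simp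
      have lt': "entry \<pi> j < entry \<pi> j'" using max'[of j] le b by auto
      have "p = (real j, real (entry \<pi> j)) \<and> j = i'"
        if "p \<in> hook_curve \<pi> (i, j) \<inter> hook_curve \<pi> (i', j')" for p
        using that lt le lt' b unfolding E by auto
      then show ?thesis
        by (auto simp: meet_only_at_endpoints_def endpoints_def sw_endpoint_def ne_endpoint_def
            pt_def)
    qed
  }
qed

section \<open>Reduced configurations as marked permutations\<close>

definition marking :: "nat list \<Rightarrow> nat set \<Rightarrow> bool" where
  "marking \<pi> N \<longleftrightarrow> N \<subseteq> {1..length \<pi>} \<and> (\<forall>j\<in>N. j - 1 \<notin> descents \<pi>) \<and>
     (\<forall>j\<in>{1..length \<pi>}. j \<in> N \<or> j \<in> descents \<pi> \<or> j - 1 \<in> descents \<pi>)"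

lemma descentsD: "i \<in> descents \<pi> \<Longrightarrow> 1 \<le> i \<and> i < length \<pi> \<and> entry \<pi> (i + 1) < entry \<pi> i"
  by (simp add: descents_def)

lemma finite_descents [simp]: "finite (descents \<pi>)"
  by (rule finite_subset[of _ "{..length \<pi>}"]) (auto dest: descentsD)

lemma pt_image_eq_iff: "pt \<pi> ` A = pt \<pi> ` B \<longleftrightarrow> A = B"
  by (intro inj_image_eq_iff injI) (simp add: pt_def)

lemma entry_inj:
  assumes "distinct \<pi>" "i \<in> {1..length \<pi>}" "j \<in> {1..length \<pi>}" "entry \<pi> i = entry \<pi> j"
  shows "i = j"
proof -
  have "i - 1 = j - 1"
    using assms by (intro iffD1[OF nth_eq_iff_index_eq]) (auto simp: entry_def)
  then show ?thesis using assms by auto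
qed

text \<open>As \<open>j\<close> is not a descent bottom, an earlier entry above
  \<open>entry \<pi> j\<close> would form a 312 pattern with the positions \<open>j - 1\<close> and
  \<open>j\<close>.\<close>

lemma left_to_right_max:
  assumes dist: "distinct \<pi>" and av: "avoids_312 \<pi>"
    and l: "1 \<le> l" "l < j" "j \<le> length \<pi>" and nd: "j - 1 \<notin> descents \<pi>"
  shows "entry \<pi> l < entry \<pi> j"
proof -
  have "entry \<pi> (j - 1) \<le> entry \<pi> j"
    using nd l by (auto simp: descents_def)
  moreover have "entry \<pi> (j - 1) \<noteq> entry \<pi> j"
    using entry_inj[OF dist, of "j - 1" j] l by fastforce
  ultimately have lt: "entry \<pi> (j - 1) < entry \<pi> j" by simp
  show ?thesis
  proof (cases "l = j - 1")
    case False
    then have "\<not> entry \<pi> j < entry \<pi> l"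
      using av lt l unfolding avoids_312_def
      by (metis One_nat_def Suc_pred diff_less le_neq_implies_less less_Suc_eq_le zero_less_one less_nat_zero_code linorder_neqE_nat)
    moreover have "entry \<pi> l \<noteq> entry \<pi> j"
      using entry_inj[OF dist, of l j] l by auto
    ultimately show ?thesis by simp
  qed (use lt in simp)
qed

text \<open>All geometry is traded for positions: that no point lies above a hook amounts to no NE
  endpoint being a descent bottom, because 312-avoidance then makes each NE endpoint a left-to-right
  maximum. Reducedness becomes the covering clause of \<open>marking\<close>.\<close>

lemma valid_hook_config_iff:
  assumes dist: "distinct \<pi>" and av: "avoids_312 \<pi>"
  shows "valid_hook_config \<pi> H \<and> reduced \<pi> H \<longleftrightarrow>
    noncrossing_matching (descents \<pi>) (snd ` H) H \<and> marking \<pi> (snd ` H)"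
    (is "?V \<longleftrightarrow> ?M")
proof -
  have sw: "sw_endpoint \<pi> ` H = descent_tops \<pi> \<longleftrightarrow> fst ` H = descents \<pi>"
    using pt_image_eq_iff[of \<pi> "fst ` H" "descents \<pi>"]
    by (simp add: image_image sw_endpoint_def descent_tops_def)
  have red: "reduced \<pi> H \<longleftrightarrow>
      (\<forall>j\<in>{1..length \<pi>}. j \<in> fst ` H \<or> j \<in> snd ` H \<or> j - 1 \<in> descents \<pi>)"
  proof -
    have ne: "pt \<pi> j \<in> (\<Union>h\<in>H. endpoints \<pi> h) \<longleftrightarrow> j \<in> fst ` H \<or> j \<in> snd ` H" for j
      by (auto simp: endpoints_def sw_endpoint_def ne_endpoint_def pt_def image_iff)
    have "pt \<pi> j \<in> descent_bottoms \<pi> \<longleftrightarrow> j - 1 \<in> descents \<pi>" for j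
      by (cases j) (auto simp: descent_bottoms_def pt_def dest: descentsD)
    then show ?thesis
      unfolding reduced_def plot_def ball_simps ne by blast
  qed
  show ?thesis
  proof
    assume V: ?V
    have V1: "\<forall>h\<in>H. is_hook \<pi> h"
      using V unfolding valid_hook_config_def by (elim conjE)
    have V2: "\<forall>(i, j)\<in>H. \<not> (\<exists>l. i < l \<and> l < j \<and> entry \<pi> l > entry \<pi> j)"
      using V unfolding valid_hook_config_def by (elim conjE)
    have hk: "is_hook \<pi> (i, j)" if "(i, j) \<in> H" for i j
      using V1 that by blast
    have above: "entry \<pi> l \<le> entry \<pi> j" if "(i, j) \<in> H" "i < l" "l < j" for i j l
    proof -
      have "\<not> (\<exists>l. i < l \<and> l < j \<and> entry \<pi> l > entry \<pi> j)"
        using bspec[OF V2 that(1)] by simp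
      then have "\<not> (i < l \<and> l < j \<and> entry \<pi> l > entry \<pi> j)"
        by (rule contrapos_nn) (rule exI)
      then show ?thesis using that(2,3) by simp
    qed
    have F: "fst ` H = descents \<pi>" using V sw by (simp add: valid_hook_config_def)
    have nd: "j - 1 \<notin> descents \<pi>" if "(i, j) \<in> H" for i j
    proof -
      \<comment> \<open>Position \<open>j - 1\<close> is either the SW endpoint or lies strictly
        inside the hook, where nothing rises above it.\<close>
      have "entry \<pi> (j - 1) \<le> entry \<pi> j"
        using hk[OF that] above[OF that, of "j - 1"] by (cases "i = j - 1") (auto simp: is_hook_def)
      then show ?thesis
        using hk[OF that] by (auto simp: is_hook_def descents_def)
    qed
    have mx: "entry \<pi> l < entry \<pi> j" if "(i, j) \<in> H" "1 \<le> l" "l < j" for i j l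
      using left_to_right_max[OF dist av that(2,3) _ nd[OF that(1)]] hk[OF that(1)]
      by (simp add: is_hook_def)
    have V3: "\<forall>h\<in>H. \<forall>h'\<in>H. h \<noteq> h' \<longrightarrow> meet_only_at_endpoints \<pi> h h'"
      using V unfolding valid_hook_config_def by (elim conjE)
    have meet: "meet_only_at_endpoints \<pi> (i, j) (i', j')"
      if "(i, j) \<in> H" "(i', j') \<in> H" "(i, j) \<noteq> (i', j')" for i j i' j'
      using bspec[OF bspec[OF V3 that(1)] that(2)] that(3) by (rule mp)
    have "noncrossing_matching (descents \<pi>) (snd ` H) H"
      unfolding noncrossing_matching_def
    proof (intro conjI ballI case_prodI2 impI)
      fix p i j assume "p \<in> H" "p = (i, j)"
      then show "i < j" using hk by (auto simp: is_hook_def)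
    next
      fix p i j p' i' j' assume p: "p \<in> H" "p = (i, j)" "p' \<in> H" "p' = (i', j')"
      show "j = j'" if "i = i'"
        using meet[of i j i' j'] meet_only_at_endpoints_same_sw[of \<pi> i j j'] hk p that by auto
      show "j \<le> i' \<or> j' < j" if "i < i'"
        using meet[of i j i' j'] meet_only_at_endpoints_iff[of \<pi> i j i' j'] hk mx p that by auto
    qed (use F in simp_all)
    moreover have "marking \<pi> (snd ` H)"
      using V red F nd hk by (fastforce simp: marking_def is_hook_def)
    ultimately show ?M by simp
  next
    assume M: ?M
    note D = noncrossing_matchingD[OF conjunct1[OF M]]
    note mk = conjunct2[OF M, unfolded marking_def]
    have mx: "entry \<pi> l < entry \<pi> j" if "(i, j) \<in> H" "1 \<le> l" "l < j" for i j l
    proof -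
      have "j \<in> snd ` H" using that(1) by force
      then have "j \<le> length \<pi>" "j - 1 \<notin> descents \<pi>" using mk by auto
      then show ?thesis using left_to_right_max[OF dist av that(2,3)] by simp
    qed
    have hk: "is_hook \<pi> (i, j)" if "(i, j) \<in> H" for i j
    proof -
      have "i \<in> descents \<pi>" "j \<in> snd ` H" using that D(1) by force+
      then show ?thesis
        using D(3)[OF that] mx[OF that, of i] mk by (auto simp: is_hook_def dest: descentsD)
    qed
    have "valid_hook_config \<pi> H"
      unfolding valid_hook_config_def
    proof (intro conjI ballI impI case_prodI2 notI)
      fix h assume "h \<in> H" then show "is_hook \<pi> h" using hk by (cases h) auto
    next
      show "sw_endpoint \<pi> ` H = descent_tops \<pi>" using sw D(1) by simp
    next
      fix h i j assume "h \<in> H" "h = (i, j)" "\<exists>l>i. l < j \<and> entry \<pi> j < entry \<pi> l"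
      then obtain l where "(i, j) \<in> H" "i < l" "l < j" "entry \<pi> j < entry \<pi> l" by auto
      then show False using mx[of i j l] by simp
    next
      fix h h' assume h: "h \<in> H" "h' \<in> H" "h \<noteq> h'"
      obtain i j i' j' where e: "h = (i, j)" "h' = (i', j')" by (cases h; cases h')
      consider "i = i'" | "i < i'" | "i' < i" by linarith
      then show "meet_only_at_endpoints \<pi> h h'"
      proof cases
        case 1 then show ?thesis using D(4)[of i j j'] h e by simp
      next
        case 2 then show ?thesis
          using meet_only_at_endpoints_iff[of \<pi> i j i' j'] D(5)[of i j i' j'] hk mx h e by simp
      next
        case 3 then show ?thesis
          using meet_only_at_endpoints_iff[of \<pi> i' j' i j] D(5)[of i' j' i j] hk mx h e
          by (simp add: meet_only_at_endpoints_commute[of _ "(i, j)"])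
      qed
    qed
    moreover have "reduced \<pi> H" using red D(1) mk by auto
    ultimately show ?V by simp
  qed
qed

definition marked_Av312 :: "nat \<Rightarrow> (nat list \<times> nat set) set" where
  "marked_Av312 k =
     {(\<pi>, N). \<pi> \<in> Av312 \<and> marking \<pi> N \<and> ballot (descents \<pi>) N \<and> card N = k}"

text \<open>Uniqueness of the noncrossing matching gives injectivity, and its existence under
  \<open>ballot\<close> gives surjectivity.\<close>

lemma bij_betw_RedVHC:
  "bij_betw (\<lambda>(\<pi>, H). (\<pi>, snd ` H)) (RedVHC k Av312) (marked_Av312 k)"
proof -
  have iff: "(\<pi>, H) \<in> RedVHC k Av312 \<longleftrightarrow>
      \<pi> \<in> Av312 \<and> noncrossing_matching (descents \<pi>) (snd ` H) H \<and> marking \<pi> (snd ` H) \<and> card H = k"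
    for \<pi> H
    using valid_hook_config_iff[of \<pi> H]
    by (auto simp: RedVHC_def Av312_def Av312_n_def permutations_of_set_def)
  have card: "card (snd ` H) = card H" if "noncrossing_matching T N H" for T N H
    using noncrossing_matching_inj[OF that] by (simp add: card_image)
  have fin: "finite N" if "marking \<pi> N" for \<pi> N
    using that finite_subset unfolding marking_def by blast
  show ?thesis
  proof (rule bij_betw_imageI)
    show "inj_on (\<lambda>(\<pi>, H). (\<pi>, snd ` H)) (RedVHC k Av312)"
    proof (rule inj_onI, clarsimp)
      fix \<pi> H H' assume "(\<pi>, H) \<in> RedVHC k Av312" "(\<pi>, H') \<in> RedVHC k Av312" "snd ` H = snd ` H'"
      then show "H = H'"
        using noncrossing_matching_unique[of "descents \<pi>" "snd ` H" H H'] fin by (auto simp: iff)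
    qed
    show "(\<lambda>(\<pi>, H). (\<pi>, snd ` H)) ` RedVHC k Av312 = marked_Av312 k"
    proof (intro subset_antisym subsetI)
      fix q assume "q \<in> (\<lambda>(\<pi>, H). (\<pi>, snd ` H)) ` RedVHC k Av312"
      then show "q \<in> marked_Av312 k"
        using noncrossing_matching_ballot card by (fastforce simp: iff marked_Av312_def)
    next
      fix q assume "q \<in> marked_Av312 k"
      then obtain \<pi> N where q: "q = (\<pi>, N)" "\<pi> \<in> Av312" "marking \<pi> N"
        "ballot (descents \<pi>) N" "card N = k"
        by (auto simp: marked_Av312_def)
      obtain H where H: "noncrossing_matching (descents \<pi>) N H"
        using noncrossing_matching_exists[OF q(4)] fin[OF q(3)] by auto
      then have "(\<pi>, H) \<in> RedVHC k Av312" "snd ` H = N"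
        unfolding iff using q card[OF H] noncrossing_matchingD(2)[OF H] H by auto
      then show "q \<in> (\<lambda>(\<pi>, H). (\<pi>, snd ` H)) ` RedVHC k Av312"
        using q(1) by force
    qed
  qed
qed

section \<open>The stack machine\<close>

text \<open>
  \<open>Push\<close>, \<open>Peak\<close>, \<open>Close\<close> and \<open>Pop\<close> stand for the letters \<open>X\<close>, \<open>Y\<close>, \<open>Z\<close> and the
  underlined \<open>Y\<close>. In \<open>legal a c d w\<close>, \<open>a\<close> is the height of the stack, \<open>c\<close> the number of
  descent tops still waiting for a hook, and \<open>d\<close> says whether \<open>w\<close> may start with an underlined
  letter. In \<open>emit v st w\<close>, \<open>v\<close> is the next value to be pushed on the stack \<open>st\<close>; an output value
  is marked \<open>True\<close> if it is a NE endpoint.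
\<close>

datatype move = Push | Peak | Close | Pop

fun legal :: "nat \<Rightarrow> nat \<Rightarrow> bool \<Rightarrow> move list \<Rightarrow> bool" where
  "legal a c d [] \<longleftrightarrow> a = 0 \<and> c = 0"
| "legal a c d (Push # w) \<longleftrightarrow> legal (Suc a) c False w"
| "legal a c d (Peak # w) \<longleftrightarrow> a > 0 \<and> legal (a - 1) (Suc c) True w"
| "legal a c d (Close # w) \<longleftrightarrow> c > 0 \<and> legal a (c - 1) True w"
| "legal a c d (Pop # w) \<longleftrightarrow> d \<and> a > 0 \<and> legal (a - 1) (Suc c) True w"

fun emit :: "nat \<Rightarrow> nat list \<Rightarrow> move list \<Rightarrow> (nat \<times> bool) list" where
  "emit v st [] = []"
| "emit v st (Push # w) = emit (Suc v) (v # st) w"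
| "emit v st (Peak # w) = (v, False) # (hd st, False) # emit (Suc v) (tl st) w"
| "emit v st (Close # w) = (v, True) # emit (Suc v) st w"
| "emit v st (Pop # w) = (hd st, False) # emit v (tl st) w"

text \<open>Inverse of \<open>emit\<close>: comparing the next output \<open>u\<close> with the next
  value \<open>v\<close> to be pushed determines the move. \<open>Peak\<close> accounts for two
  outputs, hence the \<open>tl s\<close>.\<close>

function read_moves :: "nat \<Rightarrow> (nat \<times> bool) list \<Rightarrow> move list" where
  "read_moves v [] = []"
| "read_moves v ((u, b) # s) =
     (if u < v then Pop # read_moves v s
      else if v < u then Push # read_moves (Suc v) ((u, b) # s)
      else if b then Close # read_moves (Suc v) s
      else Peak # read_moves (Suc v) (tl s))"
  by pat_completeness auto
termination
  \<comment> \<open>Reading a \<open>Push\<close> consumes no output, but it shrinks the gap between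
    \<open>v\<close> and the next output.\<close>
  by (relation "measures [\<lambda>(v, s). length s, \<lambda>(v, s). fst (hd s) - v]") auto

text \<open>
  Here \<open>p\<close> is the preceding entry (0 at the start) and \<open>c\<close> again the number of unmatched descent tops.
\<close>

fun well_marked :: "nat \<Rightarrow> nat \<Rightarrow> (nat \<times> bool) list \<Rightarrow> bool" where
  "well_marked p c [] \<longleftrightarrow> c = 0"
| "well_marked p c ((u, b) # s) \<longleftrightarrow>
     (if u < p then \<not> b \<and> well_marked u (Suc c) s
      else if b then c > 0 \<and> well_marked u (c - 1) s
      else s \<noteq> [] \<and> fst (hd s) < u \<and> well_marked u c s)"

text \<open>Recursive form of 312-avoidance, suited to lists produced front to back: the head is
  tried as the 3 of a pattern.\<close>

fun avoids :: "nat list \<Rightarrow> bool" where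
  "avoids [] \<longleftrightarrow> True"
| "avoids (x # xs) \<longleftrightarrow> sorted_wrt (>) (filter (\<lambda>y. y < x) xs) \<and> avoids xs"

text \<open>This is where the ban on a \<open>Pop\<close> right after a \<open>Push\<close> makes
  words readable: after pushing \<open>v\<close>, the next output exceeds \<open>v\<close>, so
  \<open>read_moves\<close> recognizes the \<open>Push\<close>.\<close>

lemma emit_hd:
  assumes "legal a c False w"
  shows "if emit v st w = [] then a = 0 else v \<le> fst (hd (emit v st w))"
  using assms
proof (induction w arbitrary: a c v st)
  case (Cons m w)
  show ?case
  proof (cases m)
    case Push
    then have "legal (Suc a) c False w" using Cons.prems by simp
    from Cons.IH[OF this, of "Suc v" "v # st"] show ?thesis
      using Push by (cases "emit (Suc v) (v # st) w = []") simp_all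
  qed (use Cons.prems in auto)
qed simp

lemma read_moves_emit:
  assumes "legal (length st) c d w" "\<forall>s\<in>set st. s < v"
  shows "read_moves v (emit v st w) = w"
  using assms
proof (induction w arbitrary: c d v st)
  case (Cons m w)
  show ?case
  proof (cases m)
    case Push
    let ?s = "emit (Suc v) (v # st) w"
    have l: "legal (length (v # st)) c False w" using Cons.prems Push by simp
    from emit_hd[OF this, of "Suc v" "v # st"] have s: "?s \<noteq> []" "Suc v \<le> fst (hd ?s)"
      by (auto split: if_splits)
    then obtain u b s' where e: "?s = (u, b) # s'" "v < u"
      by (cases ?s) auto
    have "read_moves (Suc v) ?s = w"
      using Cons.prems by (intro Cons.IH[OF l]) auto
    then show ?thesis using Push e by simp
  next
    case Peak
    then obtain x st' where "st = x # st'" using Cons.prems by (cases st) auto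
    then show ?thesis using Cons.prems Peak Cons.IH[of st' "Suc c" True "Suc v"]
      by (auto simp: less_SucI)
  next
    case Close
    then show ?thesis using Cons.prems Cons.IH[of st "c - 1" True "Suc v"]
      by (auto simp: less_SucI)
  next
    case Pop
    then obtain x st' where "st = x # st'" using Cons.prems by (cases st) auto
    then show ?thesis using Cons.prems Pop Cons.IH[of st' "Suc c" True v] by auto
  qed
qed simp

text \<open>Every move except \<open>Pop\<close> takes a fresh value, and a legal word empties the
  stack.\<close>

lemma mset_emit:
  assumes "legal (length st) c d w"
  shows "image_mset fst (mset (emit v st w)) =
    mset st + mset_set {v..<v + length (filter (\<lambda>m. m \<noteq> Pop) w)}"
  using assms
proof (induction w arbitrary: c d v st)
  case (Cons m w)
  have up: "mset_set {v..<Suc (v + n)} = add_mset v (mset_set {Suc v..<Suc (v + n)})" for n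
  proof -
    have "{v..<Suc (v + n)} = insert v {Suc v..<Suc (v + n)}" by auto
    then show ?thesis by simp
  qed
  show ?case
  proof (cases m)
    case Push
    then show ?thesis using Cons.prems Cons.IH[of "v # st" c False "Suc v"] by (simp add: up)
  next
    case Peak
    then obtain x st' where "st = x # st'" using Cons.prems by (cases st) auto
    then show ?thesis using Cons.prems Peak Cons.IH[of st' "Suc c" True "Suc v"] by (simp add: up)
  next
    case Close
    then show ?thesis using Cons.prems Cons.IH[of st "c - 1" True "Suc v"] by (simp add: up)
  next
    case Pop
    then obtain x st' where "st = x # st'" using Cons.prems by (cases st) auto
    then show ?thesis using Cons.prems Pop Cons.IH[of st' "Suc c" True v] by simp
  qed
qed simp

text \<open>The second conjunct carries the induction: the values below \<open>v\<close> still to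
  come are the stack read from the top, hence decreasing.\<close>

lemma avoids_emit:
  assumes "legal (length st) c d w" "sorted_wrt (>) st" "\<forall>s\<in>set st. s < v"
  shows "avoids (map fst (emit v st w)) \<and> filter (\<lambda>x. x < v) (map fst (emit v st w)) = st"
  using assms
proof (induction w arbitrary: c d v st)
  case (Cons m w)
  have less: "filter (\<lambda>x. x < u) xs = filter (\<lambda>x. x < u) (filter (\<lambda>x. x < u') xs)"
    if "u \<le> u'" for u u' :: nat and xs
    using that by (auto intro!: filter_cong)
  have all: "filter (\<lambda>x. x < u) xs = xs" if "\<forall>s\<in>set xs. s < u" for u :: nat and xs
    using that by (simp add: filter_id_conv)
  show ?case
  proof (cases m)
    case Push
    then have "avoids (map fst (emit (Suc v) (v # st) w)) \<and>
        filter (\<lambda>x. x < Suc v) (map fst (emit (Suc v) (v # st) w)) = v # st"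
      using Cons.prems by (intro Cons.IH[of _ c False]) auto
    then show ?thesis
      using less[of v "Suc v" "map fst (emit (Suc v) (v # st) w)"] all[of st v] Push Cons.prems
      by simp
  next
    case Peak
    then obtain x st' where st: "st = x # st'" using Cons.prems by (cases st) auto
    let ?xs = "map fst (emit (Suc v) st' w)"
    have "\<forall>s\<in>set st'. s < Suc v" using Cons.prems st by auto
    then have I: "avoids ?xs" "filter (\<lambda>x. x < Suc v) ?xs = st'"
      using Cons.prems Peak st Cons.IH[of st' "Suc c" True "Suc v"]
      by (auto intro: less_SucI)
    have "filter (\<lambda>y. y < u) ?xs = st'" if "u \<le> Suc v" "\<forall>s\<in>set st'. s < u" for u
      using less[OF that(1), of ?xs] all[OF that(2)] I by simp
    then show ?thesis using Cons.prems Peak st I by simp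
  next
    case Close
    let ?xs = "map fst (emit (Suc v) st w)"
    have "\<forall>s\<in>set st. s < Suc v" using Cons.prems by auto
    then have I: "avoids ?xs" "filter (\<lambda>x. x < Suc v) ?xs = st"
      using Cons.prems Close Cons.IH[of st "c - 1" True "Suc v"] by auto
    have "filter (\<lambda>y. y < v) ?xs = st"
      using less[of v "Suc v" ?xs] all[of st v] I Cons.prems by simp
    then show ?thesis using Cons.prems Close I by simp
  next
    case Pop
    then obtain x st' where st: "st = x # st'" using Cons.prems by (cases st) auto
    let ?xs = "map fst (emit v st' w)"
    have I: "avoids ?xs" "filter (\<lambda>x. x < v) ?xs = st'"
      using Cons.prems Pop st Cons.IH[of st' "Suc c" True v] by auto
    have "filter (\<lambda>y. y < x) ?xs = st'"
      using less[of x v ?xs] all[of st' x] I Cons.prems st by simp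
    then show ?thesis using Cons.prems Pop st I by simp
  qed
qed simp

text \<open>When \<open>d\<close> holds, the whole stack lies below the preceding output
  \<open>p\<close>, so a \<open>Pop\<close> creates a descent. A \<open>Push\<close> puts a value
  above \<open>p\<close> on the stack, which is why it resets \<open>d\<close>.\<close>

lemma well_marked_emit:
  assumes "legal (length st) c d w" "sorted_wrt (>) st" "\<forall>s\<in>set st. s < v"
    and "p < v" "d \<longrightarrow> (\<forall>s\<in>set st. s < p)"
  shows "well_marked p c (emit v st w)"
  using assms
proof (induction w arbitrary: c d v st p)
  case (Cons m w)
  show ?case
  proof (cases m)
    case Push
    have "well_marked p c (emit (Suc v) (v # st) w)"
      by (rule Cons.IH[of _ c False]) (use Cons.prems Push in \<open>auto simp: less_SucI\<close>)
    then show ?thesis using Push by simp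
  next
    case Peak
    then obtain x st' where "st = x # st'" using Cons.prems by (cases st) auto
    then show ?thesis
      using Cons.prems Peak Cons.IH[of st' "Suc c" True "Suc v" x] by (auto simp: less_SucI)
  next
    case Close
    then show ?thesis using Cons.prems Cons.IH[of st "c - 1" True "Suc v" v]
      by (auto simp: less_SucI)
  next
    case Pop
    then obtain x st' where "st = x # st'" using Cons.prems by (cases st) auto
    then show ?thesis
      using Cons.prems Pop Cons.IH[of st' "Suc c" True v x] by auto
  qed
qed simp

section \<open>Recovering the moves from a marked list\<close>

lemma filter_less_Suc_decreasing:
  assumes "sorted_wrt (>) (filter (\<lambda>y. y < u) xs)" "v < u" "v \<in> set xs"
  shows "filter (\<lambda>y. y < Suc v) xs = v # filter (\<lambda>y. y < v) xs"
  using assms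
proof (induction xs)
  case (Cons x xs)
  show ?case
  proof (cases "x = v")
    case True
    then have "v \<notin> set xs" using Cons.prems by auto
    then have "filter (\<lambda>y. y < Suc v) xs = filter (\<lambda>y. y < v) xs"
      by (auto simp: less_Suc_eq intro!: filter_cong)
    then show ?thesis using True by simp
  next
    case False
    then have "v < x" using Cons.prems by (cases "x < u") auto
    then show ?thesis using False Cons by (cases "x < u") auto
  qed
qed simp

lemma restrict_Suc:
  assumes "{x \<in> A. v \<le> x} = {v..<n}"
  shows "{x \<in> A. Suc v \<le> x} = {Suc v..<n}"
proof -
  have "{x \<in> A. Suc v \<le> x} = {x \<in> A. v \<le> x} - {v}" by auto
  also have "\<dots> = {Suc v..<n}"
    unfolding assms by auto
  finally show ?thesis .
qed

text \<open>The stack can be recovered from the future: it consists of the smaller values still to come.\<close>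

lemma emit_read_moves:
  fixes s :: "(nat \<times> bool) list"
  defines "below \<equiv> \<lambda>v s. filter (\<lambda>x. x < v) (map fst s)"
  assumes "distinct (map fst s)" "avoids (map fst s)" "{x \<in> fst ` set s. v \<le> x} = {v..<n}"
    and "well_marked p c s" "p < v" "sorted_wrt (>) (below v s)"
    and "s \<noteq> [] \<longrightarrow> d \<or> v \<le> fst (hd s)" "d \<longrightarrow> (\<forall>x\<in>set (below v s). x < p)"
  shows "legal (length (below v s)) c d (read_moves v s) \<and> emit v (below v s) (read_moves v s) = s"
  using assms(2-)
proof (induction v s arbitrary: p c d rule: read_moves.induct)
  case (1 v)
  then show ?case by (simp add: below_def)
next
  case (2 v u b s)
  consider "u < v" | "v < u" | "u = v" "b" | "u = v" "\<not> b" by linarith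
  then show ?case
  proof cases
    case 1
    have st: "below v ((u, b) # s) = u # below v s" for b using 1 by (simp add: below_def)
    have "{x \<in> fst ` set s. v \<le> x} = {v..<n}"
      using 2(7) 1 by auto
    \<comment> \<open>As \<open>u < v\<close>, the hypothesis on the first entry leaves only
      \<open>d\<close>, which gives \<open>u < p\<close>. So \<open>u\<close> is a descent bottom
      and cannot carry a mark.\<close>
    moreover have "d" "u < p" "\<forall>x\<in>set (below v s). x < u" "sorted_wrt (>) (below v s)"
      using 2(10-) 1 by (auto simp: st)
    moreover have "\<not> b" "well_marked u (Suc c) s"
      using 2(8) \<open>u < p\<close> by simp_all
    ultimately show ?thesis
      using "2.IH"(1)[OF 1, of u "Suc c" True] 1 2(5,6) by (simp add: st)
  next
    case 2
    note prems = "2.prems"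
    \<comment> \<open>The values from \<open>v\<close> on that are still to come form an interval
      containing \<open>u\<close>, so \<open>v\<close> itself comes later. Values below
      \<open>u\<close> come in decreasing order, so \<open>v\<close> precedes the smaller ones and
      belongs on top of the stack.\<close>
    have "u \<in> {v..<n}" unfolding prems(3)[symmetric] using 2 by simp
    then have "v \<in> {v..<n}" using 2 by simp
    then have "v \<in> fst ` set s" unfolding prems(3)[symmetric] using 2 by simp
    then have st: "below (Suc v) ((u, b) # s) = v # below v ((u, b) # s)" for b
      using filter_less_Suc_decreasing[of u "map fst s" v] prems(2) 2 by (simp add: below_def)
    have "{x \<in> fst ` set ((u, b) # s). Suc v \<le> x} = {Suc v..<n}"
      by (rule restrict_Suc[OF prems(3)])
    moreover have "sorted_wrt (>) (v # below v ((u, b) # s))"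
      using prems(6) by (simp add: below_def)
    ultimately show ?thesis
      using "2.IH"(2)[of p c False] 2 prems by (simp add: st)
  next
    case 3
    note prems = "2.prems"
    have nv: "v \<notin> fst ` set s" using prems(1) 3 by auto
    have st: "below v ((v, b) # s) = below v s" for b by (simp add: below_def)
    have st': "below (Suc v) s = below v s"
      using nv by (auto simp: below_def less_Suc_eq intro!: filter_cong)
    have "{x \<in> fst ` set s. Suc v \<le> x} = {Suc v..<n}"
      using 3 by (subst restrict_Suc[OF prems(3), symmetric]) auto
    moreover have "c > 0" "well_marked v (c - 1) s"
      using prems(4,5) 3 by auto
    moreover have "\<forall>x\<in>set (below v s). x < v" by (auto simp: below_def)
    ultimately show ?thesis
      using "2.IH"(3)[of v "c - 1" True] 3 prems by (simp add: st st')
  next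
    case 4
    note prems = "2.prems"
    \<comment> \<open>The entry \<open>v\<close> exceeds \<open>p\<close> and is unmarked, so
      \<open>well_marked\<close> makes it a descent top; the smaller entry after it is the top of
      the stack.\<close>
    obtain x b' s' where s: "s = (x, b') # s'" "x < v"
      using prems(4,5) 4 by (cases s) auto
    have wm: "\<not> b'" "well_marked x (Suc c) s'"
      using prems(4,5) 4 s by auto
    have nv: "v \<notin> fst ` set s'" using prems(1) 4 s by auto
    have st: "below v ((v, b) # (x, b'') # s') = x # below v s'" for b b'' using s by (simp add: below_def)
    have st': "below (Suc v) s' = below v s'"
      using nv by (auto simp: below_def less_Suc_eq intro!: filter_cong)
    have "{x \<in> fst ` set s'. Suc v \<le> x} = {Suc v..<n}"
      using 4 s by (subst restrict_Suc[OF prems(3), symmetric]) auto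
    then show ?thesis
      using "2.IH"(4)[of x "Suc c" True] 4 prems s wm by (simp add: st st')
  qed
qed

section \<open>Letter counts and the bijection between words and marked lists\<close>

lemma count_marks_emit: "count_list (map snd (emit v st w)) True = count_list w Close"
  by (induction v st w rule: emit.induct) auto

lemma length_emit:
  "length (emit v st w) = 2 * count_list w Peak + count_list w Close + count_list w Pop"
  by (induction v st w rule: emit.induct) auto

text \<open>The number of waiting descent tops rises at each \<open>Peak\<close> and
  \<open>Pop\<close>, falls at each \<open>Close\<close> and ends at 0.\<close>

lemma legal_count:
  "legal a c d w \<Longrightarrow> c + count_list w Peak + count_list w Pop = count_list w Close"
  by (induction a c d w rule: legal.induct) auto

definition move_words :: "nat \<Rightarrow> move list set" where
  "move_words k = {w. legal 0 0 False w \<and> count_list w Close = k}"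

definition marked_lists :: "nat \<Rightarrow> (nat \<times> bool) list set" where
  "marked_lists k = {s. distinct (map fst s) \<and> fst ` set s = {1..length s} \<and>
     avoids (map fst s) \<and> well_marked 0 0 s \<and> count_list (map snd s) True = k}"

lemma emit_mem_marked_lists:
  assumes "w \<in> move_words k"
  shows "emit 1 [] w \<in> marked_lists k"
proof -
  have l: "legal (length []) 0 False w" using assms by (simp add: move_words_def)
  let ?m = "length (filter (\<lambda>m. m \<noteq> Pop) w)" and ?s = "emit 1 [] w"
  \<comment> \<open>One multiset equation yields the value set, the length and distinctness.\<close>
  have m: "mset (map fst ?s) = mset_set {1..?m}"
    using mset_emit[OF l, of 1] by (simp add: atLeastLessThanSuc_atLeastAtMost)
  have "fst ` set ?s = {1..?m}"
    using arg_cong[OF m, of set_mset] by simp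
  moreover have "length ?s = ?m" using arg_cong[OF m, of size] by simp
  moreover have "distinct (map fst ?s)"
    using m mset_eq_imp_distinct_iff[of "map fst ?s" "[1..<Suc ?m]"]
    by (simp add: atLeastLessThanSuc_atLeastAtMost del: upt_Suc)
  ultimately show ?thesis
    using avoids_emit[OF l, of 1] well_marked_emit[OF l, of 1 0] assms
    by (simp add: marked_lists_def move_words_def count_marks_emit)
qed

lemma emit_read_moves_marked_lists:
  assumes "s \<in> marked_lists k"
  shows "read_moves 1 s \<in> move_words k" "emit 1 [] (read_moves 1 s) = s"
proof -
  have s: "distinct (map fst s)" "fst ` set s = {1..length s}" "avoids (map fst s)" "well_marked 0 0 s"
    using assms by (simp_all add: marked_lists_def)
  have pos: "\<forall>x\<in>fst ` set s. 1 \<le> x" unfolding s(2) by simp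
  then have below: "filter (\<lambda>x. x < 1) (map fst s) = []" by (auto simp: filter_empty_conv)
  have "{x \<in> fst ` set s. 1 \<le> x} = {1..<Suc (length s)}"
    unfolding s(2) by auto
  moreover have "s \<noteq> [] \<longrightarrow> 1 \<le> fst (hd s)" using pos by auto
  ultimately have "legal 0 0 False (read_moves 1 s) \<and> emit 1 [] (read_moves 1 s) = s"
    using emit_read_moves[of s 1 "Suc (length s)" 0 0 False] s below by simp
  then show "emit 1 [] (read_moves 1 s) = s" "read_moves 1 s \<in> move_words k"
    using assms count_marks_emit[of 1 "[]" "read_moves 1 s"]
    by (simp_all add: marked_lists_def move_words_def)
qed

lemma bij_betw_read_moves: "bij_betw (read_moves 1) (marked_lists k) (move_words k)"
proof (rule bij_betw_byWitness[where f' = "emit 1 []"])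
  show "\<forall>w\<in>move_words k. read_moves 1 (emit 1 [] w) = w"
    using read_moves_emit[of "[]" 0 False] by (simp add: move_words_def)
qed (use emit_read_moves_marked_lists emit_mem_marked_lists in auto)

section \<open>Underlined words and marked permutations\<close>

fun letter_of :: "move \<Rightarrow> letter" where
  "letter_of Push = X" | "letter_of Peak = Y" | "letter_of Close = Z" | "letter_of Pop = Y"

fun move_of :: "letter \<Rightarrow> bool \<Rightarrow> move" where
  "move_of X u = Push" | "move_of Y u = (if u then Pop else Peak)" | "move_of Z u = Close"

definition underlined_word :: "move list \<Rightarrow> letter list \<times> nat set" where
  "underlined_word w = (map letter_of w, {p. p < length w \<and> w ! p = Pop})"

lemma all_nat_split: "(\<forall>n. P n) \<longleftrightarrow> P 0 \<and> (\<forall>n. P (Suc n))"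
  by (metis not0_implies_Suc)

lemma all_le_Suc_split: "(\<forall>m\<le>Suc n. P m) \<longleftrightarrow> P 0 \<and> (\<forall>m\<le>n. P (Suc m))"
  by (subst all_nat_split) simp

text \<open>The prefix condition for the rest of a word, where \<open>a\<close> and \<open>c\<close>
  are the surpluses of X over Y and of Y over Z accumulated so far.\<close>

definition prefix_dominated :: "nat \<Rightarrow> nat \<Rightarrow> letter list \<Rightarrow> bool" where
  "prefix_dominated a c w \<longleftrightarrow> (\<forall>m\<le>length w.
     count_list (take m w) Y \<le> a + count_list (take m w) X \<and>
     count_list (take m w) Z \<le> c + count_list (take m w) Y)"

lemma prefix_dominated_simps:
  "prefix_dominated a c []"
  "prefix_dominated a c (X # w) \<longleftrightarrow> prefix_dominated (Suc a) c w"
  "prefix_dominated a c (Y # w) \<longleftrightarrow> a > 0 \<and> prefix_dominated (a - 1) (Suc c) w"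
  "prefix_dominated a c (Z # w) \<longleftrightarrow> c > 0 \<and> prefix_dominated a (c - 1) w"
proof -
  show "prefix_dominated a c (Y # w) \<longleftrightarrow> a > 0 \<and> prefix_dominated (a - 1) (Suc c) w"
    by (cases a) (auto simp: prefix_dominated_def all_le_Suc_split)
  show "prefix_dominated a c (Z # w) \<longleftrightarrow> c > 0 \<and> prefix_dominated a (c - 1) w"
    by (cases c) (auto simp: prefix_dominated_def all_le_Suc_split)
qed (auto simp: prefix_dominated_def all_le_Suc_split)

definition pops_allowed :: "bool \<Rightarrow> move list \<Rightarrow> bool" where
  "pops_allowed d w \<longleftrightarrow>
     (\<forall>p<length w. w ! p = Pop \<longrightarrow> (if p = 0 then d else w ! (p - 1) \<noteq> Push))"

lemma pops_allowed_Cons: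
  "pops_allowed d (m # w) \<longleftrightarrow> (m = Pop \<longrightarrow> d) \<and> pops_allowed (m \<noteq> Push) w"
  unfolding pops_allowed_def
  by (subst all_nat_split) (auto simp: nth_Cons' gr0_conv_Suc)

text \<open>The counters of \<open>legal\<close> are exactly these surpluses: staying nonnegative is
  the prefix condition, and ending at zero gives the two count equations.\<close>

lemma legal_iff:
  "legal a c d w \<longleftrightarrow> prefix_dominated a c (map letter_of w) \<and> pops_allowed d w \<and>
     a + count_list (map letter_of w) X = count_list (map letter_of w) Y \<and>
     c + count_list (map letter_of w) Y = count_list (map letter_of w) Z"
proof (induction a c d w rule: legal.induct)
  case (1 a c d)
  then show ?case by (simp add: prefix_dominated_simps pops_allowed_def)
qed (auto simp: prefix_dominated_simps pops_allowed_Cons)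

lemma count_letters:
  "count_list (map letter_of w) Y = count_list w Peak + count_list w Pop"
  "count_list (map letter_of w) Z = count_list w Close"
proof (induction w)
  case (Cons m w)
  case 1 from Cons show ?case by (cases m) simp_all
  case 2 from Cons show ?case by (cases m) simp_all
qed simp_all

lemma underlined_word_mem:
  "underlined_word w \<in> underlined_duck_words k \<longleftrightarrow> w \<in> move_words k"
proof -
  have X: "letter_of m = X \<longleftrightarrow> m = Push" for m by (cases m) auto
  \<comment> \<open>The flag is immaterial at the start of the word, since nothing can be popped
    from an empty stack. This matches the duck words, which restrict an underlined Y only by a
    letter before it.\<close>
  have True_iff: "legal 0 0 False w \<longleftrightarrow> legal 0 0 True w"
  proof (cases w)
    case (Cons m w')
    then show ?thesis by (cases m) auto
  qed simp
  have pops: "pops_allowed True w \<longleftrightarrow>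
      (\<forall>p\<in>{p. p < length w \<and> w ! p = Pop}. \<not> (p > 0 \<and> map letter_of w ! (p - 1) = X))"
    by (auto simp: pops_allowed_def X)
  have "{p. p < length w \<and> w ! p = Pop} \<subseteq>
      {p. p < length (map letter_of w) \<and> map letter_of w ! p = Y}"
    by auto
  then have "underlined_word w \<in> underlined_duck_words k \<longleftrightarrow>
      map letter_of w \<in> dyck3_words k \<and> pops_allowed True w"
    unfolding underlined_word_def underlined_duck_words_def pops by simp
  also have "map letter_of w \<in> dyck3_words k \<longleftrightarrow> prefix_dominated 0 0 (map letter_of w) \<and>
      (\<forall>l. count_list (map letter_of w) l = k)"
    unfolding dyck3_words_def prefix_dominated_def by (auto, metis letter.exhaust)
  also have "\<dots> \<and> pops_allowed True w \<longleftrightarrow> legal 0 0 True w \<and> count_list (map letter_of w) Z = k"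
    unfolding legal_iff by (auto, metis letter.exhaust)
  also have "\<dots> \<longleftrightarrow> w \<in> move_words k"
    by (simp add: move_words_def True_iff count_letters)
  finally show ?thesis .
qed

lemma bij_betw_underlined_word:
  "bij_betw underlined_word (move_words k) (underlined_duck_words k)"
proof -
  define g where "g = (\<lambda>(w, U). map (\<lambda>p. move_of (w ! p) (p \<in> U)) [0..<length w])"
  have letter: "letter_of (move_of l u) = l" for l u by (cases l) auto
  have Pop: "move_of l u = Pop \<longleftrightarrow> l = Y \<and> u" for l u by (cases l) auto
  have move: "move_of (letter_of m) (m = Pop) = m" for m by (cases m) auto
  have gf: "g (underlined_word w) = w" for w
    by (rule nth_equalityI) (auto simp: g_def underlined_word_def move)
  have fg: "underlined_word (g q) = q" if "q \<in> underlined_duck_words k" for q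
  proof -
    obtain w U where q: "q = (w, U)" "U \<subseteq> {p. p < length w \<and> w ! p = Y}"
      using \<open>q \<in> underlined_duck_words k\<close> by (auto simp: underlined_duck_words_def)
    have "map letter_of (g q) = w"
      by (rule nth_equalityI) (auto simp: g_def q(1) letter)
    moreover have "{p. p < length (g q) \<and> g q ! p = Pop} = U"
      using q(2) by (auto simp: g_def q(1) Pop)
    ultimately show ?thesis by (simp add: underlined_word_def q(1))
  qed
  show ?thesis
    by (rule bij_betw_byWitness[where f' = g]) (use gf fg underlined_word_mem in fastforce)+
qed

lemma card_underlined: "card (snd (underlined_word w)) = count_list w Pop"
  by (simp add: underlined_word_def count_list_eq_length_filter length_filter_conv_card
      conj_commute eq_commute)

section \<open>The two forms of 312-avoidance\<close>

lemma all_pairs_less_Suc: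
  "(\<forall>b c. b < c \<longrightarrow> c < Suc n \<longrightarrow> P b c) \<longleftrightarrow>
    (\<forall>c<n. P 0 (Suc c)) \<and> (\<forall>b c. b < c \<longrightarrow> c < n \<longrightarrow> P (Suc b) (Suc c))"
    (is "?L \<longleftrightarrow> ?R")
proof
  assume ?R
  then have "P b c" if "b < c" "c < Suc n" for b c
    using that by (cases b; cases c) auto
  then show ?L by blast
qed simp

lemma all_triples_less_Suc:
  "(\<forall>a b c. a < b \<longrightarrow> b < c \<longrightarrow> c < Suc n \<longrightarrow> P a b c) \<longleftrightarrow>
    (\<forall>b c. b < c \<longrightarrow> c < n \<longrightarrow> P 0 (Suc b) (Suc c)) \<and>
    (\<forall>a b c. a < b \<longrightarrow> b < c \<longrightarrow> c < n \<longrightarrow> P (Suc a) (Suc b) (Suc c))"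
    (is "?L \<longleftrightarrow> ?R")
proof
  assume ?R
  then have "P a b c" if "a < b" "b < c" "c < Suc n" for a b c
    using that by (cases a; cases b; cases c) auto
  then show ?L by blast
qed simp

lemma sorted_wrt_filter_iff:
  "sorted_wrt R (filter P xs) \<longleftrightarrow> (\<forall>b c. b < c \<longrightarrow> c < length xs \<longrightarrow>
     P (xs ! b) \<longrightarrow> P (xs ! c) \<longrightarrow> R (xs ! b) (xs ! c))"
proof (induction xs)
  case (Cons x xs)
  have "(\<forall>y\<in>set xs. P y \<longrightarrow> R x y) \<longleftrightarrow> (\<forall>c<length xs. P (xs ! c) \<longrightarrow> R x (xs ! c))"
    unfolding all_set_conv_all_nth ..
  then show ?case
    unfolding length_Cons all_pairs_less_Suc by (auto simp: Cons.IH)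
qed simp

text \<open>Distinctness turns "no increasing pair below the head" into "decreasing below the head";
  the rest is the shift from list indices to positions.\<close>

lemma avoids_iff:
  assumes "distinct xs"
  shows "avoids xs \<longleftrightarrow> avoids_312 xs"
proof -
  have "avoids xs \<longleftrightarrow> (\<forall>a b c. a < b \<longrightarrow> b < c \<longrightarrow> c < length xs \<longrightarrow>
      \<not> (xs ! b < xs ! c \<and> xs ! c < xs ! a))"
    using assms
  proof (induction xs)
    case (Cons x xs)
    have "xs ! b \<noteq> xs ! c" if "b < c" "c < length xs" for b c
      using that Cons.prems by (simp add: nth_eq_iff_index_eq)
    then have "(xs ! b < x \<longrightarrow> xs ! c < x \<longrightarrow> xs ! b > xs ! c) \<longleftrightarrow> \<not> (xs ! b < xs ! c \<and> xs ! c < x)"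
      if "b < c" "c < length xs" for b c
      using that by (metis less_trans linorder_neqE_nat less_asym)
    then have "sorted_wrt (>) (filter (\<lambda>y. y < x) xs) \<longleftrightarrow>
        (\<forall>b c. b < c \<longrightarrow> c < length xs \<longrightarrow> \<not> (xs ! b < xs ! c \<and> xs ! c < x))"
      unfolding sorted_wrt_filter_iff by presburger
    then show ?case
      unfolding length_Cons all_triples_less_Suc using Cons by simp
  qed simp
  also have "\<dots> \<longleftrightarrow> avoids_312 xs"
  proof
    assume L: "\<forall>a b c. a < b \<longrightarrow> b < c \<longrightarrow> c < length xs \<longrightarrow> \<not> (xs ! b < xs ! c \<and> xs ! c < xs ! a)"
    have False if "1 \<le> a" "a < b" "b < c" "c \<le> length xs" "entry xs b < entry xs c"
      "entry xs c < entry xs a" for a b c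
      using L[rule_format, of "a - 1" "b - 1" "c - 1"] that by (simp add: entry_def)
    then show "avoids_312 xs" unfolding avoids_312_def by blast
  next
    assume av: "avoids_312 xs"
    have False if "a < b" "b < c" "c < length xs" "xs ! b < xs ! c" "xs ! c < xs ! a" for a b c
    proof -
      have "1 \<le> Suc a \<and> Suc a < Suc b \<and> Suc b < Suc c \<and> Suc c \<le> length xs \<and>
          entry xs (Suc b) < entry xs (Suc c) \<and> entry xs (Suc c) < entry xs (Suc a)"
        using that by (simp add: entry_def)
      then show False using av unfolding avoids_312_def by blast
    qed
    then show "\<forall>a b c. a < b \<longrightarrow> b < c \<longrightarrow> c < length xs \<longrightarrow> \<not> (xs ! b < xs ! c \<and> xs ! c < xs ! a)"
      by blast
  qed
  finally show ?thesis .
qed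

section \<open>Marked permutations as lists of marked entries\<close>

definition mark_entries :: "nat list \<times> nat set \<Rightarrow> (nat \<times> bool) list" where
  "mark_entries = (\<lambda>(\<pi>, N). map (\<lambda>p. (\<pi> ! p, Suc p \<in> N)) [0..<length \<pi>])"

lemma length_mark_entries [simp]: "length (mark_entries (\<pi>, N)) = length \<pi>"
  by (simp add: mark_entries_def)

lemma map_fst_mark_entries [simp]: "map fst (mark_entries (\<pi>, N)) = \<pi>"
  by (rule nth_equalityI) (simp_all add: mark_entries_def)

definition count_below :: "nat set \<Rightarrow> nat \<Rightarrow> nat" where
  "count_below A p = card {x \<in> A. x < p}"

lemma count_below_Suc:
  assumes "finite A"
  shows "count_below A (Suc p) = (if p \<in> A then Suc (count_below A p) else count_below A p)"
proof -
  have "{x \<in> A. x < Suc p} = (if p \<in> A then insert p {x \<in> A. x < p} else {x \<in> A. x < p})"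
    by (auto simp: less_Suc_eq)
  then show ?thesis using assms by (simp add: count_below_def)
qed

lemma count_below_card:
  assumes "\<And>x. x \<in> A \<Longrightarrow> x < p"
  shows "count_below A p = card A"
proof -
  have "{x \<in> A. x < p} = A" using assms by auto
  then show ?thesis by (simp add: count_below_def)
qed

lemma Suc_mem_descents_iff:
  "Suc p \<in> descents \<pi> \<longleftrightarrow> Suc p < length \<pi> \<and> \<pi> ! Suc p < \<pi> ! p"
  by (auto simp: descents_def entry_def)

lemma zero_notin_descents [simp]: "0 \<notin> descents \<pi>"
  by (simp add: descents_def)

text \<open>Invariant after reading \<open>p\<close> entries: \<open>c\<close> is the number of
  descents whose bottom has been read minus the number of marks read. A descent at \<open>p\<close>
  itself is not yet counted, hence \<open>Suc p\<close> for \<open>N\<close> but \<open>p\<close>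
  for the descents.\<close>

lemma well_marked_drop_iff:
  assumes N: "N \<subseteq> {1..length \<pi>}" and p: "p \<le> length \<pi>"
    and c: "c + count_below N (Suc p) = count_below (descents \<pi>) p"
  shows "well_marked (if p = 0 then 0 else \<pi> ! (p - 1)) c (drop p (mark_entries (\<pi>, N))) \<longleftrightarrow>
    (\<forall>j\<in>{Suc p..length \<pi>}.
       (j \<in> N \<longrightarrow> j - 1 \<notin> descents \<pi> \<and> count_below N j < count_below (descents \<pi>) j) \<and>
       (j \<in> N \<or> j \<in> descents \<pi> \<or> j - 1 \<in> descents \<pi>)) \<and>
    card (descents \<pi>) = card N" (is "_ \<longleftrightarrow> (\<forall>j\<in>_. ?step j) \<and> _")
  using p c
proof (induction "length \<pi> - p" arbitrary: p c)
  case 0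
  have "count_below N (Suc p) = card N"
    using N 0 by (intro count_below_card) auto
  moreover have "count_below (descents \<pi>) p = card (descents \<pi>)"
    using 0 by (intro count_below_card) (auto dest: descentsD)
  ultimately show ?case using 0 by auto
next
  case (Suc n)
  let ?D = "descents \<pi>" and ?s = "mark_entries (\<pi>, N)"
  have p: "p < length \<pi>" using Suc.hyps(2) by simp
  have fin: "finite N" using N finite_subset by blast
  note cnt = count_below_Suc[OF fin] count_below_Suc[OF finite_descents]
  have drop: "drop p ?s = (\<pi> ! p, Suc p \<in> N) # drop (Suc p) ?s"
    using p by (simp add: Cons_nth_drop_Suc[symmetric] mark_entries_def)
  have next_desc: "drop (Suc p) ?s \<noteq> [] \<and> fst (hd (drop (Suc p) ?s)) < \<pi> ! p \<longleftrightarrow> Suc p \<in> ?D"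
    by (auto simp: Suc_mem_descents_iff hd_drop_conv_nth mark_entries_def)
  \<comment> \<open>The default 0 before the first entry ensures that position 1 is never a descent
    bottom.\<close>
  have prev_desc: "\<pi> ! p < (if p = 0 then 0 else \<pi> ! (p - 1)) \<longleftrightarrow> p \<in> ?D"
    using p by (cases p) (auto simp: Suc_mem_descents_iff)
  have split: "(\<forall>j\<in>{Suc p..length \<pi>}. ?step j) \<longleftrightarrow>
      ?step (Suc p) \<and> (\<forall>j\<in>{Suc (Suc p)..length \<pi>}. ?step j)"
  proof -
    have "{Suc p..length \<pi>} = insert (Suc p) {Suc (Suc p)..length \<pi>}" using p by auto
    then show ?thesis by simp
  qed
  have IH: "well_marked (\<pi> ! p) c' (drop (Suc p) ?s) \<longleftrightarrow>
      (\<forall>j\<in>{Suc (Suc p)..length \<pi>}. ?step j) \<and> card ?D = card N"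
    if "c' + count_below N (Suc (Suc p)) = count_below ?D (Suc p)" for c'
    using Suc.hyps(1)[of "Suc p" c'] Suc.hyps(2) p that by simp
  \<comment> \<open>The cases follow the branches of \<open>well_marked\<close>. In the first and
    third both sides are false: a marked descent bottom, and a mark with no descent top
    waiting.\<close>
  consider "p \<in> ?D" "Suc p \<in> N" | "p \<in> ?D" "Suc p \<notin> N" | "p \<notin> ?D" "Suc p \<in> N" "c = 0"
    | "p \<notin> ?D" "Suc p \<in> N" "c > 0" | "p \<notin> ?D" "Suc p \<notin> N" by blast
  then show ?case
  proof cases
    case 1
    then show ?thesis unfolding split drop well_marked.simps prev_desc by simp
  next
    case 2
    then show ?thesis
      using IH[of "Suc c"] Suc.prems(2)
      unfolding split drop well_marked.simps prev_desc by (simp add: cnt)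
  next
    case 3
    then show ?thesis
      using Suc.prems(2) unfolding split drop well_marked.simps prev_desc by (simp add: cnt)
  next
    case 4
    then show ?thesis
      using IH[of "c - 1"] Suc.prems(2)
      unfolding split drop well_marked.simps prev_desc by (simp add: cnt)
  next
    case 5
    then show ?thesis
      using IH[of c] Suc.prems(2) next_desc
      unfolding split drop well_marked.simps prev_desc by (auto simp: cnt)
  qed
qed

lemma well_marked_iff:
  assumes N: "N \<subseteq> {1..length \<pi>}"
  shows "well_marked 0 0 (mark_entries (\<pi>, N)) \<longleftrightarrow> marking \<pi> N \<and> ballot (descents \<pi>) N"
proof -
  have "{x \<in> N. x < Suc 0} = {}" using N by auto
  then have "0 + count_below N (Suc 0) = count_below (descents \<pi>) 0"
    by (simp add: count_below_def)
  from well_marked_drop_iff[OF N _ this] show ?thesis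
    using N unfolding marking_def ballot_def count_below_def by auto
qed

lemma count_marks_mark_entries:
  assumes "N \<subseteq> {1..length \<pi>}"
  shows "count_list (map snd (mark_entries (\<pi>, N))) True = card N"
proof -
  have "map snd (mark_entries (\<pi>, N)) = map (\<lambda>p. Suc p \<in> N) [0..<length \<pi>]"
    by (simp add: mark_entries_def)
  then have "count_list (map snd (mark_entries (\<pi>, N))) True = card {p. p < length \<pi> \<and> Suc p \<in> N}"
    by (simp add: count_list_eq_length_filter length_filter_conv_card)
      (intro arg_cong[of _ _ card], auto)
  also have "\<dots> = card (Suc ` {p. p < length \<pi> \<and> Suc p \<in> N})"
    by (simp add: card_image)
  also have "Suc ` {p. p < length \<pi> \<and> Suc p \<in> N} = N"
  proof (intro subset_antisym subsetI)
    fix x assume "x \<in> N"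
    then show "x \<in> Suc ` {p. p < length \<pi> \<and> Suc p \<in> N}"
      using assms by (cases x) auto
  qed auto
  finally show ?thesis .
qed

lemma Av312_iff: "\<pi> \<in> Av312_n n \<longleftrightarrow> \<pi> \<in> Av312 \<and> length \<pi> = n"
proof -
  have "length \<pi> = m" if "\<pi> \<in> Av312_n m" for m
    using that distinct_card[of \<pi>] by (simp add: Av312_n_def permutations_of_set_def)
  then show ?thesis unfolding Av312_def by blast
qed

lemma mem_Av312:
  "\<pi> \<in> Av312 \<longleftrightarrow> distinct \<pi> \<and> set \<pi> = {1..length \<pi>} \<and> avoids \<pi>"
proof -
  have "\<pi> \<in> Av312 \<longleftrightarrow> \<pi> \<in> Av312_n (length \<pi>)" by (simp add: Av312_iff)
  also have "\<dots> \<longleftrightarrow> distinct \<pi> \<and> set \<pi> = {1..length \<pi>} \<and> avoids_312 \<pi>"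
    by (auto simp: Av312_n_def permutations_of_set_def)
  finally show ?thesis using avoids_iff[of \<pi>] by blast
qed

lemma mark_entries_mem:
  assumes "N \<subseteq> {1..length \<pi>}"
  shows "mark_entries (\<pi>, N) \<in> marked_lists k \<longleftrightarrow> (\<pi>, N) \<in> marked_Av312 k"
proof -
  have "fst ` set (mark_entries (\<pi>, N)) = set \<pi>"
    by (metis map_fst_mark_entries set_map)
  then show ?thesis
    by (auto simp: marked_lists_def marked_Av312_def mem_Av312 well_marked_iff[OF assms]
        count_marks_mark_entries[OF assms])
qed

lemma bij_betw_mark_entries: "bij_betw mark_entries (marked_Av312 k) (marked_lists k)"
proof -
  define g where "g = (\<lambda>s :: (nat \<times> bool) list. (map fst s, {j \<in> {1..length s}. snd (s ! (j - 1))}))"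
  have sub: "N \<subseteq> {1..length \<pi>}" if "(\<pi>, N) \<in> marked_Av312 k" for \<pi> N
    using that by (auto simp: marked_Av312_def marking_def)
  have fg: "mark_entries (g s) = s" for s
    by (rule nth_equalityI) (auto simp: g_def mark_entries_def)
  have gf: "g (mark_entries (\<pi>, N)) = (\<pi>, N)" if "N \<subseteq> {1..length \<pi>}" for \<pi> N
  proof -
    have "snd (mark_entries (\<pi>, N) ! (j - 1)) \<longleftrightarrow> j \<in> N" if "j \<in> {1..length \<pi>}" for j
      using that by (cases j) (auto simp: mark_entries_def)
    then have "{j \<in> {1..length \<pi>}. snd (mark_entries (\<pi>, N) ! (j - 1))} = N"
      using that by blast
    then show ?thesis by (simp add: g_def)
  qed
  have g_mem: "g s \<in> marked_Av312 k" if "s \<in> marked_lists k" for s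
  proof -
    have "snd (g s) \<subseteq> {1..length (fst (g s))}" by (auto simp: g_def)
    from mark_entries_mem[OF this, of k] show ?thesis using that fg[of s] by simp
  qed
  show ?thesis
  proof (rule bij_betw_byWitness[where f' = g])
    show "\<forall>q\<in>marked_Av312 k. g (mark_entries q) = q"
      using gf sub by auto
    show "mark_entries ` marked_Av312 k \<subseteq> marked_lists k"
      using mark_entries_mem sub by auto
  qed (use fg g_mem in auto)
qed

section \<open>The composite bijection and its effect on length\<close>

definition duck_word :: "nat list \<times> (nat \<times> nat) set \<Rightarrow> letter list \<times> nat set" where
  "duck_word = underlined_word \<circ> read_moves 1 \<circ> mark_entries \<circ> (\<lambda>(\<pi>, H). (\<pi>, snd ` H))"

lemma bij_betw_duck_word: "bij_betw duck_word (RedVHC k Av312) (underlined_duck_words k)"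
  unfolding duck_word_def
  by (intro bij_betw_trans[OF bij_betw_RedVHC] bij_betw_trans[OF bij_betw_mark_entries]
      bij_betw_trans[OF bij_betw_read_moves] bij_betw_underlined_word)

text \<open>The length is twice the number of \<open>Peak\<close> moves plus the numbers of
  \<open>Close\<close> and \<open>Pop\<close> moves. Since \<open>Peak\<close> and
  \<open>Pop\<close> together occur \<open>k\<close> times, as does \<open>Close\<close>, adding the
  number of \<open>Pop\<close> moves gives \<open>3 * k\<close>.\<close>

lemma card_duck_word:
  assumes "(\<pi>, H) \<in> RedVHC k Av312"
  shows "length \<pi> + card (snd (duck_word (\<pi>, H))) = 3 * k"
proof -
  let ?s = "mark_entries (\<pi>, snd ` H)"
  have "(\<pi>, snd ` H) \<in> marked_Av312 k"
    using bij_betw_apply[OF bij_betw_RedVHC assms] by simp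
  then have s: "?s \<in> marked_lists k"
    using bij_betw_apply[OF bij_betw_mark_entries] by blast
  let ?w = "read_moves 1 ?s"
  have "legal 0 0 False ?w" "count_list ?w Close = k" "emit 1 [] ?w = ?s"
    using emit_read_moves_marked_lists[OF s] by (simp_all add: move_words_def)
  moreover have "length \<pi> = length ?s" by simp
  ultimately show ?thesis
    using legal_count[of 0 0 False ?w] length_emit[of 1 "[]" ?w]
    by (simp add: duck_word_def card_underlined)
qed

theorem theorem4p1:
  fixes k :: nat
  assumes "k \<ge> 1"
  shows "(\<exists>f. bij_betw f (RedVHC k Av312) (underlined_duck_words k)) \<and>
         (\<forall>i::nat. 0 \<le> i \<and> i \<le> k - 1 \<longrightarrow>
            (\<exists>g. bij_betw g (RedVHC k (Av312_n (3 * k - i))) (underlined_duck_words_i k i)))"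
proof (intro conjI allI impI exI)
  show bij: "bij_betw duck_word (RedVHC k Av312) (underlined_duck_words k)"
    by (rule bij_betw_duck_word)
  fix i :: nat assume i: "0 \<le> i \<and> i \<le> k - 1"
  \<comment> \<open>The bound on \<open>i\<close> keeps the subtraction \<open>3 * k - i\<close>
    from being truncated.\<close>
  have size: "length \<pi> = 3 * k - i \<longleftrightarrow> card (snd (duck_word (\<pi>, H))) = i"
    if "(\<pi>, H) \<in> RedVHC k Av312" for \<pi> H
    using card_duck_word[OF that] i by linarith
  have sub: "RedVHC k (Av312_n (3 * k - i)) =
      {q \<in> RedVHC k Av312. card (snd (duck_word q)) = i}"
    using size by (auto simp: RedVHC_def Av312_iff)
  have "duck_word ` {q \<in> RedVHC k Av312. card (snd (duck_word q)) = i} =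
      {x \<in> duck_word ` RedVHC k Av312. card (snd x) = i}"
    by auto
  also have "\<dots> = underlined_duck_words_i k i"
    unfolding bij_betw_imp_surj_on[OF bij] by (auto simp: underlined_duck_words_i_def)
  finally show "bij_betw duck_word (RedVHC k (Av312_n (3 * k - i))) (underlined_duck_words_i k i)"
    unfolding sub by (intro bij_betw_subset[OF bij]) auto
qed

end
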